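(* There exist an absolute constant $C>0$ and, for every instance of the linearly correlated prophet problem, an inclusion-threshold algorithm $\mathrm{ALG}$ such that \[\mathbb{E}[\mathrm{ALG}] \ \ge\ \frac{1}{C\cdot \min\{s_{\mathrm{col}},s_{\mathrm{row}}\}}\,\mathbb{E}\big[\max_i X_i\big],\] where $s_{\mathrm{row}}$ and $s_{\mathrm{col}}$ are the row and column sparsity of the instance's matrix. That is, the problem admits an inclusion-threshold algorithm with approximation ratio $O(\min\{s_{\mathrm{col}},s_{\mathrm{row}}\})$.
   Context: Linearly correlated prophet problem: there are $m$ mutually independent nonnegative random variables $Y_1,\dots,Y_m$ and a matrix $A\in\mathbb{R}_{\ge 0}^{n\times m}$; the values are $\mathbf{X}=A\mathbf{Y}$, i.e. $X_i=\sum_j A_{ij}Y_j$. The row sparsity $s_{\mathrm{row}}$ is the maximum number of nonzero entries in a row of $A$; the column sparsity $s_{\mathrm{col}}$ is the maximum number of nonzero entries in a column of $A$. An online algorithm is given $A$ and the distributions of the $Y_j$; it then observes the realizations of $X_1,\dots,X_n$ one at a time (it never observes the $Y_j$ themselves), and after observing $X_i$ it either stops and receives reward $X_i$, or irrevocably rejects $X_i$ and proceeds to $X_{i+1}$. $\mathrm{ALG}$ denotes its (random) reward. An algorithm has approximation ratio $\alpha$ if $\mathbb{E}[\mathrm{ALG}]\ge \frac{1}{\alpha}\mathbb{E}[\max_i X_i]$ on every instance. An inclusion-threshold algorithm chooses (possibly at random, before observing any values) a subset $S\subseteq\{1,\dots,n\}$ and a threshold $\tau$, and selects the first $X_i$ with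 $i\in S$ and $X_i\ge\tau$. *)

theory Defs
  imports "HOL-Probability.Probability"
begin

text \<open>
  Rows (the observed values) are indexed by \<open>{..<n}\<close> and columns (the hidden variables) by
  \<open>{..<m}\<close>, both starting from 0; a matrix is a function whose entries outside this range are
  irrelevant.  An instance is given by the matrix \<open>A\<close> and the laws \<open>\<mu> j\<close> of the independent
  hidden variables, which are realised as the coordinates of \<open>PiM {..<m} \<mu>\<close>.
  The transfer lemmas at the end show that any other realisation by independent random variables
  gives the same expectations.
\<close>

definition lin_instance :: "nat \<Rightarrow> nat \<Rightarrow> (nat \<Rightarrow> nat \<Rightarrow> real) \<Rightarrow> (nat \<Rightarrow> real measure) \<Rightarrow> bool" where
  "lin_instance n m A \<mu> \<longleftrightarrow>
     0 < n \<and> 0 < m \<and>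
     (\<forall>i<n. \<forall>j<m. 0 \<le> A i j) \<and>
     (\<forall>j<m. prob_space (\<mu> j) \<and> sets (\<mu> j) = sets borel \<and> (AE y in \<mu> j. 0 \<le> y))"

definition row_sparsity :: "nat \<Rightarrow> nat \<Rightarrow> (nat \<Rightarrow> nat \<Rightarrow> real) \<Rightarrow> nat" where
  "row_sparsity n m A = Max ((\<lambda>i. card {j. j < m \<and> A i j \<noteq> 0}) ` {..<n})"

definition col_sparsity :: "nat \<Rightarrow> nat \<Rightarrow> (nat \<Rightarrow> nat \<Rightarrow> real) \<Rightarrow> nat" where
  "col_sparsity n m A = Max ((\<lambda>j. card {i. i < n \<and> A i j \<noteq> 0}) ` {..<m})"

definition lin_value :: "nat \<Rightarrow> (nat \<Rightarrow> nat \<Rightarrow> real) \<Rightarrow> (nat \<Rightarrow> real) \<Rightarrow> nat \<Rightarrow> real" where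
  "lin_value m A y i = (\<Sum>j<m. A i j * y j)"

definition max_value :: "nat \<Rightarrow> nat \<Rightarrow> (nat \<Rightarrow> nat \<Rightarrow> real) \<Rightarrow> (nat \<Rightarrow> real) \<Rightarrow> real" where
  "max_value n m A y = Max (lin_value m A y ` {..<n})"

text \<open>Expectations are nonnegative integrals, so that no integrability has to be assumed.\<close>

definition expected_max ::
    "nat \<Rightarrow> nat \<Rightarrow> (nat \<Rightarrow> nat \<Rightarrow> real) \<Rightarrow> (nat \<Rightarrow> real measure) \<Rightarrow> ennreal" where
  "expected_max n m A \<mu> = (\<integral>\<^sup>+ y. ennreal (max_value n m A y) \<partial>(PiM {..<m} \<mu>))"

text \<open>
  The reward collected on the value sequence \<open>x\<close> by the rule that stops at the first
  \<open>i \<in> S\<close> with \<open>x i \<ge> \<tau>\<close>; the reward is 0 if the rule never stops.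
\<close>

definition threshold_reward :: "nat \<Rightarrow> nat set \<Rightarrow> real \<Rightarrow> (nat \<Rightarrow> real) \<Rightarrow> real" where
  "threshold_reward n S \<tau> x =
     (case find (\<lambda>i. i \<in> S \<and> \<tau> \<le> x i) [0..<n] of None \<Rightarrow> 0 | Some i \<Rightarrow> x i)"

text \<open>
  An inclusion-threshold algorithm is identified with the joint law \<open>D\<close> of the pair
  \<open>(S, \<tau>)\<close> it draws before seeing any value.  The draw is independent of the hidden variables,
  whence the product measure in \<open>expected_reward\<close>.
\<close>

definition inclusion_threshold_alg :: "nat \<Rightarrow> (nat set \<times> real) measure \<Rightarrow> bool" where
  "inclusion_threshold_alg n D \<longleftrightarrow>
     prob_space D \<and> sets D = sets (count_space (Pow {..<n}) \<Otimes>\<^sub>M (borel :: real measure))"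

definition expected_reward ::
    "nat \<Rightarrow> nat \<Rightarrow> (nat \<Rightarrow> nat \<Rightarrow> real) \<Rightarrow> (nat \<Rightarrow> real measure) \<Rightarrow> (nat set \<times> real) measure \<Rightarrow> ennreal"
  where
  "expected_reward n m A \<mu> D =
     (\<integral>\<^sup>+ ((S, \<tau>), y). ennreal (threshold_reward n S \<tau> (lin_value m A y)) \<partial>(D \<Otimes>\<^sub>M PiM {..<m} \<mu>))"

lemma lin_value_measurable:
  assumes "\<And>j. j < m \<Longrightarrow> sets (\<mu> j) = sets borel"
  shows "(\<lambda>y. lin_value m A y i) \<in> borel_measurable (PiM {..<m} \<mu>)"
proof -
  have "(\<lambda>y. y j) \<in> borel_measurable (PiM {..<m} \<mu>)" if "j < m" for j
    using measurable_component_singleton[of j "{..<m}" \<mu>] that assms[OF that]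
    by (simp cong: measurable_cong_sets)
  then show ?thesis
    unfolding lin_value_def by (intro borel_measurable_sum borel_measurable_times) auto
qed

lemma max_value_measurable:
  assumes "\<And>j. j < m \<Longrightarrow> sets (\<mu> j) = sets borel"
  shows "max_value n m A \<in> borel_measurable (PiM {..<m} \<mu>)"
proof -
  have *: "(\<lambda>y. Max ((\<lambda>i. lin_value m A y i) ` {..<n})) \<in> borel_measurable (PiM {..<m} \<mu>)"
    using lin_value_measurable[OF assms] by (intro borel_measurable_Max) auto
  show ?thesis
    using * unfolding max_value_def[abs_def] by simp
qed

lemma threshold_reward_measurable:
  assumes "\<And>j. j < m \<Longrightarrow> sets (\<mu> j) = sets borel"
    and "sets D = sets (count_space (Pow {..<n}) \<Otimes>\<^sub>M (borel :: real measure))"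
  shows "(\<lambda>((S, \<tau>), y). threshold_reward n S \<tau> (lin_value m A y))
           \<in> borel_measurable (D \<Otimes>\<^sub>M PiM {..<m} \<mu>)"
proof -
  let ?N = "(count_space (Pow {..<n}) \<Otimes>\<^sub>M (borel :: real measure)) \<Otimes>\<^sub>M PiM {..<m} \<mu>"
  note [measurable] = lin_value_measurable[OF assms(1)]
  have mem: "Measurable.pred ?N (\<lambda>p. i \<in> fst (fst p))" for i
  proof -
    have "(\<lambda>p. fst (fst p)) \<in> ?N \<rightarrow>\<^sub>M count_space (Pow {..<n})" by measurable
    moreover have "(\<lambda>S. i \<in> S) \<in> count_space (Pow {..<n}) \<rightarrow>\<^sub>M count_space UNIV" by simp
    ultimately show ?thesis by (rule measurable_compose)
  qed
  have val: "(\<lambda>p. lin_value m A (snd p) i) \<in> borel_measurable ?N" for i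
    by measurable
  have "(\<lambda>p. case find (\<lambda>i. i \<in> fst (fst p) \<and> snd (fst p) \<le> lin_value m A (snd p) i) is of
            None \<Rightarrow> 0 | Some i \<Rightarrow> lin_value m A (snd p) i) \<in> borel_measurable ?N" for "is"
  proof (induction "is")
    case (Cons i "is")
    note [measurable] = mem[of i] val[of i] Cons
    have "(\<lambda>p. if i \<in> fst (fst p) \<and> snd (fst p) \<le> lin_value m A (snd p) i
               then lin_value m A (snd p) i
               else (case find (\<lambda>i. i \<in> fst (fst p) \<and> snd (fst p) \<le> lin_value m A (snd p) i) is of
                 None \<Rightarrow> 0 | Some i \<Rightarrow> lin_value m A (snd p) i)) \<in> borel_measurable ?N"
      by measurable
    then show ?case
      by (rule measurable_cong[THEN iffD1, rotated]) auto
  qed simp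
  from this[of "[0..<n]"] have *: "(\<lambda>((S, \<tau>), y). threshold_reward n S \<tau> (lin_value m A y)) \<in> borel_measurable ?N"
    unfolding threshold_reward_def by (simp add: case_prod_beta')
  have "sets (D \<Otimes>\<^sub>M PiM {..<m} \<mu>) = sets ?N"
    using assms(2) by (intro sets_pair_measure_cong) auto
  then show ?thesis using * by (simp cong: measurable_cong_sets)
qed

lemma (in prob_space) distr_hidden_variables:
  assumes "0 < m" and "indep_vars (\<lambda>_. borel) Y {..<m}"
  shows "distr M (PiM {..<m} (\<lambda>j. distr M borel (Y j))) (\<lambda>\<omega>. \<lambda>j\<in>{..<m}. Y j \<omega>)
           = PiM {..<m} (\<lambda>j. distr M borel (Y j :: 'a \<Rightarrow> real))"
    and "(\<lambda>\<omega>. \<lambda>j\<in>{..<m}. Y j \<omega>) \<in> M \<rightarrow>\<^sub>M PiM {..<m} (\<lambda>j. distr M borel (Y j))"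
proof -
  have rv: "random_variable borel (Y j)" if "j \<in> {..<m}" for j
    using assms(2) that by (auto simp: indep_vars_def)
  have s: "sets (PiM {..<m} (\<lambda>j. distr M borel (Y j))) = sets (PiM {..<m} (\<lambda>_. borel))"
    by (intro sets_PiM_cong) auto
  have ne: "{..<m} \<noteq> {}" using assms(1) by (auto simp: lessThan_empty_iff)
  have "distr M (PiM {..<m} (\<lambda>_. borel)) (\<lambda>\<omega>. \<lambda>j\<in>{..<m}. Y j \<omega>)
          = PiM {..<m} (\<lambda>j. distr M borel (Y j))"
    using assms(2) ne indep_vars_iff_distr_eq_PiM'[where I = "{..<m}" and M' = "\<lambda>_. borel" and X = Y] rv by auto
  then show "distr M (PiM {..<m} (\<lambda>j. distr M borel (Y j))) (\<lambda>\<omega>. \<lambda>j\<in>{..<m}. Y j \<omega>)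
           = PiM {..<m} (\<lambda>j. distr M borel (Y j))"
    using s by (simp cong: distr_cong)
  show "(\<lambda>\<omega>. \<lambda>j\<in>{..<m}. Y j \<omega>) \<in> M \<rightarrow>\<^sub>M PiM {..<m} (\<lambda>j. distr M borel (Y j))"
    using rv by (intro measurable_restrict) auto
qed

lemma lin_value_restrict [simp]: "lin_value m A (restrict y {..<m}) = lin_value m A y"
  by (auto simp: lin_value_def)

lemma (in prob_space) expected_max_transfer:
  fixes Y :: "nat \<Rightarrow> 'a \<Rightarrow> real"
  assumes "0 < m" and "indep_vars (\<lambda>_. borel) Y {..<m}"
  shows "expected_max n m A (\<lambda>j. distr M borel (Y j))
           = (\<integral>\<^sup>+ \<omega>. ennreal (max_value n m A (\<lambda>j. Y j \<omega>)) \<partial>M)"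
proof -
  let ?P = "PiM {..<m} (\<lambda>j. distr M borel (Y j))"
  have meas: "(\<lambda>y. ennreal (max_value n m A y)) \<in> borel_measurable ?P"
    using max_value_measurable[of m "\<lambda>j. distr M borel (Y j)" n A] by simp
  have "expected_max n m A (\<lambda>j. distr M borel (Y j))
          = (\<integral>\<^sup>+ y. ennreal (max_value n m A y) \<partial>(distr M ?P (\<lambda>\<omega>. \<lambda>j\<in>{..<m}. Y j \<omega>)))"
    unfolding expected_max_def distr_hidden_variables(1)[OF assms] ..
  also have "\<dots> = (\<integral>\<^sup>+ \<omega>. ennreal (max_value n m A (\<lambda>j\<in>{..<m}. Y j \<omega>)) \<partial>M)"
    by (rule nn_integral_distr[OF distr_hidden_variables(2)[OF assms]]) (use meas in simp)
  finally show ?thesis by (simp add: max_value_def)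
qed

lemma (in prob_space) expected_reward_transfer:
  fixes Y :: "nat \<Rightarrow> 'a \<Rightarrow> real"
  assumes "0 < m" and "indep_vars (\<lambda>_. borel) Y {..<m}" and "inclusion_threshold_alg n D"
  shows "expected_reward n m A (\<lambda>j. distr M borel (Y j)) D
           = (\<integral>\<^sup>+ ((S, \<tau>), \<omega>). ennreal (threshold_reward n S \<tau> (lin_value m A (\<lambda>j. Y j \<omega>))) \<partial>(D \<Otimes>\<^sub>M M))"
proof -
  let ?P = "PiM {..<m} (\<lambda>j. distr M borel (Y j))"
  let ?R = "\<lambda>\<omega>. \<lambda>j\<in>{..<m}. Y j \<omega>"
  let ?f = "\<lambda>((S, \<tau>), y). ennreal (threshold_reward n S \<tau> (lin_value m A y))"
  interpret D: prob_space D using assms(3) by (simp add: inclusion_threshold_alg_def)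
  note R = distr_hidden_variables[OF assms(1,2)]
  interpret P: prob_space ?P
    using prob_space_distr[OF R(2)] R(1) by simp
  have "(\<lambda>p. ennreal ((\<lambda>((S, \<tau>), y). threshold_reward n S \<tau> (lin_value m A y)) p))
          \<in> borel_measurable (D \<Otimes>\<^sub>M ?P)"
    using threshold_reward_measurable[of m "\<lambda>j. distr M borel (Y j)" D n A] assms(3)
    by (intro measurable_compose[OF _ measurable_ennreal]) (auto simp: inclusion_threshold_alg_def)
  then have meas: "?f \<in> borel_measurable (D \<Otimes>\<^sub>M ?P)"
    by (simp add: case_prod_beta')
  have meas': "(\<lambda>p. (fst p, ?R (snd p))) \<in> D \<Otimes>\<^sub>M M \<rightarrow>\<^sub>M D \<Otimes>\<^sub>M ?P"
    using R(2) by measurable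
  have "D \<Otimes>\<^sub>M ?P = distr D D (\<lambda>x. x) \<Otimes>\<^sub>M distr M ?P ?R"
    using R(1) by (simp add: distr_id2)
  also have "\<dots> = distr (D \<Otimes>\<^sub>M M) (D \<Otimes>\<^sub>M ?P) (\<lambda>(x, y). (x, ?R y))"
  proof (rule pair_measure_distr)
    show "sigma_finite_measure (distr M ?P ?R)"
      unfolding R(1) by unfold_locales
  qed (use R(2) in auto)
  finally have eq: "D \<Otimes>\<^sub>M ?P = distr (D \<Otimes>\<^sub>M M) (D \<Otimes>\<^sub>M ?P) (\<lambda>p. (fst p, ?R (snd p)))"
    by (simp add: case_prod_beta')
  have "integral\<^sup>N (D \<Otimes>\<^sub>M ?P) ?f = (\<integral>\<^sup>+ p. ?f (fst p, ?R (snd p)) \<partial>(D \<Otimes>\<^sub>M M))"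
    by (subst eq, rule nn_integral_distr[OF meas']) (use meas in simp)
  then show ?thesis
    by (simp add: expected_reward_def case_prod_beta')
qed

end

theory Submission
  imports Defs
begin

text \<open>
  Let \<open>M\<close> be the maximal value, \<open>E\<close> its mean (the case \<open>E = \<infinity>\<close> is settled by a single row) and
  \<open>t = E / 8\<close>.  If \<open>M \<ge> t\<close> has probability at least one half, threshold \<open>t\<close> on all rows earns
  \<open>E / 16\<close>.  Otherwise consider the peaks \<open>Z j = (max i. A i j) * Y j\<close>.  A Hoffmann-Joergensen
  argument shows that the large peaks \<open>Z j \<ge> t\<close> then have total mean at least \<open>E / 4\<close>.
  A random set of rows (sampled directly at rate
  \<open>1 / s_col\<close>, or through columns sampled at rate \<open>1 / s_row\<close>) contains, for each \<open>j\<close>, the peak row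
  of \<open>j\<close> and no other row involving \<open>Y j\<close> with probability at least \<open>1 / (3 s)\<close>; fix a set that
  attains the average.  The other rows in the set are then independent of \<open>Y j\<close> and all stay below
  \<open>t\<close> with probability at least one half, so each surviving large peak is collected with that
  probability.
\<close>

section \<open>Random subsets with independent inclusion\<close>

text \<open>For \<open>p\<close> in the unit interval this is the probability that a random subset
  of \<open>U\<close>, including each point independently at rate \<open>p\<close>, contains
  \<open>u\<close> and misses \<open>B\<close>.\<close>

lemma sum_bernoulli_weights:
  fixes p :: real
  assumes "finite U" "u \<in> U" "B \<subseteq> U - {u}"
  shows "(\<Sum>R\<in>{R. R \<subseteq> U \<and> u \<in> R \<and> R \<inter> B = {}}. p ^ card R * (1 - p) ^ card (U - R))
           = p * (1 - p) ^ card B"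
proof -
  \<comment> \<open>\<open>f\<close> is the factor of an included point and \<open>g\<close> that of
    an omitted one. Setting \<open>f\<close> to 0 on \<open>B\<close> and \<open>g\<close> to 0 at
    \<open>u\<close> kills the unwanted subsets, so the full expansion of the product of
    \<open>f i + g i\<close> yields the restricted sum.\<close>
  define f where "f = (\<lambda>i. if i \<in> B then 0 else p)"
  define g where "g = (\<lambda>i. if i = u then 0 else 1 - p)"
  have fin: "finite R" if "R \<subseteq> U" for R
    using assms(1) that by (rule rev_finite_subset)
  have weight: "prod f R * prod g (U - R) =
      (if u \<in> R \<and> R \<inter> B = {} then p ^ card R * (1 - p) ^ card (U - R) else 0)"
    if "R \<subseteq> U" for R
  proof (cases "u \<in> R \<and> R \<inter> B = {}")
    case True
    have "prod f R = (\<Prod>i\<in>R. p)"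
      by (rule prod.cong) (use True in \<open>auto simp: f_def\<close>)
    moreover have "prod g (U - R) = (\<Prod>i\<in>U - R. 1 - p)"
      by (rule prod.cong) (use True in \<open>auto simp: g_def\<close>)
    ultimately show ?thesis using True by simp
  next
    case False
    then consider "u \<notin> R" | i where "i \<in> R" "i \<in> B" by auto
    then show ?thesis
    proof cases
      case 1
      then have "prod g (U - R) = 0"
        using assms by (intro prod_zero) (auto simp: g_def)
      then show ?thesis using False by (auto split: if_splits)
    next
      case 2
      then have "prod f R = 0"
        using fin[OF that] by (intro prod_zero) (auto simp: f_def)
      then show ?thesis using False by (auto split: if_splits)
    qed
  qed
  have "(\<Sum>R\<in>{R. R \<subseteq> U \<and> u \<in> R \<and> R \<inter> B = {}}. p ^ card R * (1 - p) ^ card (U - R))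
      = (\<Sum>R\<in>Pow U. if u \<in> R \<and> R \<inter> B = {} then p ^ card R * (1 - p) ^ card (U - R) else 0)"
    using assms(1) by (intro sum.mono_neutral_cong_left) auto
  also have "\<dots> = (\<Sum>R\<in>Pow U. prod f R * prod g (U - R))"
    by (intro sum.cong) (auto simp: weight)
  also have "\<dots> = (\<Prod>i\<in>U. f i + g i)"
    using prod_add[OF assms(1), of f g] by simp
  also have "\<dots> = (\<Prod>i\<in>U. (if i = u then p else 1) * (if i \<in> B then 1 - p else 1))"
    using assms(3) by (intro prod.cong) (auto simp: f_def g_def)
  also have "\<dots> = p * (1 - p) ^ card B"
  proof -
    have "U \<inter> B = B" using assms(3) by auto
    then have "(\<Prod>i\<in>U. if i \<in> B then 1 - p else 1) = (1 - p) ^ card B"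
      using prod.inter_restrict[OF assms(1), of "\<lambda>_. 1 - p" B] by simp
    then show ?thesis
      using assms(1,2) by (simp add: prod.distrib)
  qed
  finally show ?thesis .
qed

text \<open>The worst case is \<open>k = s - 1\<close>, where the power is at least
  \<open>1 / exp 1\<close>, by \<open>1 + x \<le> exp x\<close> at \<open>x = 1 / (s - 1)\<close>;
  then \<open>exp 1 \<le> 3\<close>.\<close>

lemma bernoulli_survival_ge:
  fixes s k :: nat
  assumes "k < s"
  shows "1 / (3 * real s) \<le> 1 / real s * (1 - 1 / real s) ^ k"
proof (cases "s = 1")
  case False
  with assms have s: "2 \<le> s" by linarith
  define q where "q = 1 - 1 / real s"
  have q: "0 < q" "q \<le> 1" using s by (auto simp: q_def field_simps)
  have "1 / q = 1 + 1 / real (s - 1)"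
    using s by (simp add: q_def field_simps of_nat_diff)
  also have "\<dots> \<le> exp (1 / real (s - 1))"
    by (rule exp_ge_add_one_self)
  finally have "(1 / q) ^ (s - 1) \<le> exp (1 / real (s - 1)) ^ (s - 1)"
    using q by (intro power_mono) auto
  also have "\<dots> = exp 1"
    using s by (simp flip: exp_of_nat_mult)
  also have "\<dots> \<le> 3" by (rule exp_le)
  finally have "1 / 3 \<le> q ^ (s - 1)"
    using q by (simp add: power_divide field_simps)
  also have "\<dots> \<le> q ^ k"
    using q assms by (intro power_decreasing) auto
  finally show ?thesis
    using s by (simp add: q_def field_simps)
qed (use assms in auto)

text \<open>Averaging: \<open>B j\<close> holds the points in conflict with \<open>u j\<close>. At
  rate \<open>1 / s\<close>, the point \<open>u j\<close> is sampled without conflict with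
  probability at least \<open>1 / (3 s)\<close>, so the mean surviving weight is at least
  \<open>sum w J / (3 s)\<close>, and some subset does as well as the mean.\<close>

lemma exists_sampled_subset:
  fixes w :: "'b \<Rightarrow> real" and u :: "'b \<Rightarrow> 'a"
  assumes "finite U" "finite J"
    and u: "\<And>j. j \<in> J \<Longrightarrow> u j \<in> U" and B: "\<And>j. j \<in> J \<Longrightarrow> B j \<subseteq> U - {u j}"
    and card: "\<And>j. j \<in> J \<Longrightarrow> card (B j) < s" and w: "\<And>j. j \<in> J \<Longrightarrow> 0 \<le> w j"
  shows "\<exists>R\<subseteq>U. sum w J \<le> 3 * real s * sum w {j\<in>J. u j \<in> R \<and> R \<inter> B j = {}}"
proof (cases "J = {}")
  case False
  then have "s > 0" using card by fastforce
  define p where "p = 1 / real s"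
  have p: "0 \<le> p" "p \<le> 1" using \<open>s > 0\<close> by (auto simp: p_def)
  define v where "v = (\<lambda>R. p ^ card R * (1 - p) ^ card (U - R))"
  have v: "0 \<le> v R" for R using p by (simp add: v_def)
  have v1: "sum v (Pow U) = 1"
    using prod_add[OF assms(1), of "\<lambda>_. p" "\<lambda>_. 1 - p"] by (simp add: v_def)
  define G where "G = (\<lambda>R. sum w {j\<in>J. u j \<in> R \<and> R \<inter> B j = {}})"
  show ?thesis
  proof (rule ccontr)
    assume "\<not> ?thesis"
    then have less: "3 * real s * G R < sum w J" if "R \<subseteq> U" for R
      using that by (auto simp: G_def not_le)
    \<comment> \<open>The average of the strict inequalities is strict only if some subset has
      positive probability; for \<open>s = 1\<close> only \<open>U\<close> has. One exists because
      the probabilities sum to 1.\<close>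
    obtain R0 where R0: "R0 \<in> Pow U" "0 < v R0"
      using v1 v by (metis leI less_irrefl order_antisym sum.neutral zero_neq_one)
    have "(\<Sum>R\<in>Pow U. v R * (3 * real s * G R)) < (\<Sum>R\<in>Pow U. v R * sum w J)"
    proof (rule sum_strict_mono_ex1)
      show "\<forall>R\<in>Pow U. v R * (3 * real s * G R) \<le> v R * sum w J"
        by (intro ballI mult_left_mono less_imp_le[OF less] v) simp
      show "\<exists>R\<in>Pow U. v R * (3 * real s * G R) < v R * sum w J"
        using R0 less[of R0] by (intro bexI[of _ R0] mult_strict_left_mono) simp_all
    qed (use assms in auto)
    also have "\<dots> = sum w J" by (simp add: v1 flip: sum_distrib_right)
    also have "sum w J \<le> (\<Sum>j\<in>J. w j * (3 * real s * (p * (1 - p) ^ card (B j))))"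
    proof (rule sum_mono)
      fix j assume j: "j \<in> J"
      have "1 \<le> 3 * real s * (p * (1 - p) ^ card (B j))"
        using bernoulli_survival_ge[OF card[OF j]] \<open>s > 0\<close> by (simp add: p_def field_simps)
      then show "w j \<le> w j * (3 * real s * (p * (1 - p) ^ card (B j)))"
        using w[OF j] by (simp add: mult_le_cancel_left1)
    qed
    also have "\<dots> = (\<Sum>j\<in>J. \<Sum>R\<in>Pow U. if u j \<in> R \<and> R \<inter> B j = {} then v R * (3 * real s * w j) else 0)"
    proof (rule sum.cong)
      fix j assume j: "j \<in> J"
      have "{R. R \<subseteq> U \<and> u j \<in> R \<and> R \<inter> B j = {}} = Pow U \<inter> {R. u j \<in> R \<and> R \<inter> B j = {}}"
        by auto
      then have "p * (1 - p) ^ card (B j) = (\<Sum>R\<in>Pow U \<inter> {R. u j \<in> R \<and> R \<inter> B j = {}}. v R)"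
        using sum_bernoulli_weights[OF assms(1) u[OF j] B[OF j], of p] by (simp add: v_def)
      then show "w j * (3 * real s * (p * (1 - p) ^ card (B j))) =
          (\<Sum>R\<in>Pow U. if u j \<in> R \<and> R \<inter> B j = {} then v R * (3 * real s * w j) else 0)"
        using assms(1)
        by (simp add: sum.inter_restrict[of "Pow U"] sum_distrib_left mult_ac)
          (auto intro!: sum.cong)
    qed simp
    also have "\<dots> = (\<Sum>R\<in>Pow U. \<Sum>j\<in>J. if u j \<in> R \<and> R \<inter> B j = {} then v R * (3 * real s * w j) else 0)"
      by (rule sum.swap)
    also have "\<dots> = (\<Sum>R\<in>Pow U. v R * (3 * real s * G R))"
      unfolding G_def sum.inter_filter[OF assms(2)] sum_distrib_left
      by (intro sum.cong) auto
    finally show False by simp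
  qed
qed (use assms in auto)

section \<open>Independence of disjoint blocks of coordinates\<close>

text \<open>Invariance under \<open>restrict\<close> expresses that \<open>a\<close> depends on the
  coordinates in \<open>K\<close> alone, and \<open>b\<close> on those in \<open>L\<close>. Folding
  the product measure into an iterated integral then separates the factors.\<close>

lemma (in product_prob_space) nn_integral_PiM_mult:
  assumes fin: "finite K" "finite L" and disj: "K \<inter> L = {}"
    and a: "a \<in> borel_measurable (PiM K M)" "\<And>x. a (restrict x K) = a x"
    and b: "b \<in> borel_measurable (PiM L M)" "\<And>x. b (restrict x L) = b x"
  shows "(\<integral>\<^sup>+ x. a x * b x \<partial>PiM (K \<union> L) M)
           = (\<integral>\<^sup>+ x. a x \<partial>PiM (K \<union> L) M) * (\<integral>\<^sup>+ x. b x \<partial>PiM (K \<union> L) M)"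
proof -
  have lift: "c \<in> borel_measurable (PiM (K \<union> L) M)"
    if "c \<in> borel_measurable (PiM N M)" "\<And>x. c (restrict x N) = c x" "N \<subseteq> K \<union> L" for c :: "_ \<Rightarrow> ennreal" and N
    using measurable_compose[OF measurable_restrict_subset[OF that(3)] that(1)] that(2) by simp
  note [measurable] = lift[OF a] lift[OF b] a(1) b(1)
  have "restrict (merge K L (x, y)) K = restrict x K" "restrict (merge K L (x, y)) L = restrict y L" for x y
    using disj by (auto simp: restrict_def merge_def fun_eq_iff)
  then have eq: "a (merge K L (x, y)) = a x" "b (merge K L (x, y)) = b y" for x y
    using a(2) b(2) by metis+
  interpret PK: prob_space "PiM K M" by (intro prob_space_PiM prob_space)
  interpret PL: prob_space "PiM L M" by (intro prob_space_PiM prob_space)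
  show ?thesis
    using a(1) b(1) lift[OF a] lift[OF b]
    by (simp add: product_nn_integral_fold[OF disj fin] eq nn_integral_cmult nn_integral_multc PK.emeasure_space_1 PL.emeasure_space_1)
qed

section \<open>Partial sums over columns, partial maxima and peaks\<close>

text \<open>The laws are probability measures at every index, also beyond \<open>m\<close>, because
  \<open>product_prob_space\<close> speaks of a whole family; an instance is padded to fit.\<close>

locale linear_prophet =
  fixes n m :: nat and A :: "nat \<Rightarrow> nat \<Rightarrow> real" and \<mu> :: "nat \<Rightarrow> real measure"
  assumes n_pos: "0 < n"
    and A_nonneg: "\<And>i j. i < n \<Longrightarrow> j < m \<Longrightarrow> 0 \<le> A i j"
    and prob_space_\<mu>: "\<And>j. prob_space (\<mu> j)"
    and sets_\<mu>: "\<And>j. sets (\<mu> j) = sets borel"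
    and AE_\<mu>_nonneg: "\<And>j. j < m \<Longrightarrow> AE y in \<mu> j. 0 \<le> y"
begin

sublocale product_prob_space \<mu> "{..<m}"
proof -
  interpret prob_space "\<mu> j" for j by (rule prob_space_\<mu>)
  show "product_prob_space \<mu>" by unfold_locales
qed

abbreviation P :: "(nat \<Rightarrow> real) measure" where
  "P \<equiv> PiM {..<m} \<mu>"

sublocale P: prob_space P
  by (intro prob_space_PiM prob_space_\<mu>)

text \<open>The sets of columns that occur are initial segments (to locate a first crossing), final
  segments (what remains after it) and complements of one column (to be independent of it).\<close>

definition part_value :: "nat set \<Rightarrow> (nat \<Rightarrow> real) \<Rightarrow> nat \<Rightarrow> real" where
  "part_value K y i = (\<Sum>j\<in>K. A i j * y j)"

definition part_max :: "nat set \<Rightarrow> (nat \<Rightarrow> real) \<Rightarrow> real" where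
  "part_max K y = Max (part_value K y ` {..<n})"

definition peak_row :: "nat \<Rightarrow> nat" where
  "peak_row j = (SOME i. i < n \<and> (\<forall>i'<n. A i' j \<le> A i j))"

definition peak :: "nat \<Rightarrow> (nat \<Rightarrow> real) \<Rightarrow> real" where
  "peak j y = A (peak_row j) j * y j"

text \<open>The truncated mean of a peak, \<open>E[Z j; Z j \<ge> t]\<close>.\<close>

definition tail :: "real \<Rightarrow> nat \<Rightarrow> ennreal" where
  "tail t j = (\<integral>\<^sup>+ y. (if t \<le> peak j y then ennreal (peak j y) else 0) \<partial>P)"

lemma peak_row:
  shows peak_row_less: "peak_row j < n" and le_peak_row: "i < n \<Longrightarrow> A i j \<le> A (peak_row j) j"
proof -
  obtain i0 where "i0 < n" "A i0 j = Max ((\<lambda>i. A i j) ` {..<n})"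
    using Max_in[of "(\<lambda>i. A i j) ` {..<n}"] n_pos by fastforce
  then have "i0 < n \<and> (\<forall>i'<n. A i' j \<le> A i0 j)" by auto
  then have "peak_row j < n \<and> (\<forall>i'<n. A i' j \<le> A (peak_row j) j)"
    unfolding peak_row_def by (rule someI)
  then show "peak_row j < n" "i < n \<Longrightarrow> A i j \<le> A (peak_row j) j" by auto
qed

lemma lin_value_eq: "lin_value m A = part_value {..<m}"
  by (auto simp: lin_value_def part_value_def fun_eq_iff)

lemma max_value_eq: "max_value n m A = part_max {..<m}"
  by (auto simp: max_value_def part_max_def lin_value_eq fun_eq_iff)

lemma part_value_le_part_max: "i < n \<Longrightarrow> part_value K y i \<le> part_max K y"
  by (simp add: part_max_def)

lemma part_max_le_iff: "part_max K y \<le> c \<longleftrightarrow> (\<forall>i<n. part_value K y i \<le> c)"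
  unfolding part_max_def using n_pos by (subst Max_le_iff) (auto simp: lessThan_empty_iff)

lemma part_max_attained: "\<exists>i<n. part_value K y i = part_max K y"
  using Max_in[of "part_value K y ` {..<n}"] n_pos by (fastforce simp: part_max_def)

lemma part_max_empty: "part_max {} y = 0"
proof -
  have "part_value {} y ` {..<n} = {0}" using n_pos by (auto simp: part_value_def)
  then show ?thesis by (simp add: part_max_def)
qed

lemma part_value_restrict: "part_value K (restrict y K) = part_value K y"
  by (auto simp: part_value_def fun_eq_iff)

lemma part_max_restrict: "part_max K (restrict y K) = part_max K y"
  by (simp add: part_max_def part_value_restrict)

lemma part_value_measurable [measurable]:
  assumes "K \<subseteq> N"
  shows "(\<lambda>y. part_value K y i) \<in> borel_measurable (PiM N \<mu>)"
proof -
  have "(\<lambda>y. y j) \<in> borel_measurable (PiM N \<mu>)" if "j \<in> K" for j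
    using measurable_component_singleton[of j N \<mu>] that assms sets_\<mu>
    by (auto cong: measurable_cong_sets)
  then show ?thesis
    unfolding part_value_def by (intro borel_measurable_sum borel_measurable_times) auto
qed

lemma part_max_measurable [measurable]:
  assumes "K \<subseteq> N"
  shows "part_max K \<in> borel_measurable (PiM N \<mu>)"
proof -
  have "(\<lambda>y. Max ((\<lambda>i. part_value K y i) ` {..<n})) \<in> borel_measurable (PiM N \<mu>)"
    using part_value_measurable[OF assms] by (intro borel_measurable_Max) auto
  then show ?thesis by (simp add: part_max_def[abs_def])
qed

lemma peak_measurable [measurable]:
  assumes "j \<in> N"
  shows "peak j \<in> borel_measurable (PiM N \<mu>)"
proof -
  have "peak j = (\<lambda>y. part_value {j} y (peak_row j))"
    by (simp add: peak_def part_value_def fun_eq_iff)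
  then show ?thesis using assms by simp
qed

lemma AE_P_nonneg: "AE y in P. \<forall>j<m. 0 \<le> y j"
proof -
  have "AE y in P. \<forall>j\<in>{..<m}. 0 \<le> y j"
    by (intro eventually_ball_finite ballI AE_PiM_component prob_space_\<mu>) (auto intro: AE_\<mu>_nonneg)
  then show ?thesis by (rule AE_mp) auto
qed

section \<open>Inequalities for a fixed nonnegative realisation\<close>

context
  fixes y :: "nat \<Rightarrow> real"
  assumes y: "\<forall>j<m. 0 \<le> y j"
begin

lemma part_value_mono:
  assumes "i < n" "K \<subseteq> N" "N \<subseteq> {..<m}"
  shows "part_value K y i \<le> part_value N y i"
  unfolding part_value_def using assms y A_nonneg
  by (intro sum_mono2 finite_subset[OF assms(3)]) (auto intro!: mult_nonneg_nonneg)

lemma part_value_nonneg: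
  assumes "i < n" "K \<subseteq> {..<m}"
  shows "0 \<le> part_value K y i"
  using part_value_mono[OF assms(1) empty_subsetI assms(2)] by (simp add: part_value_def)

lemma part_max_mono:
  assumes "K \<subseteq> N" "N \<subseteq> {..<m}"
  shows "part_max K y \<le> part_max N y"
  unfolding part_max_le_iff
  using part_value_mono[OF _ assms] part_value_le_part_max order_trans by blast

lemma peak_nonneg: "j < m \<Longrightarrow> 0 \<le> peak j y"
  using y A_nonneg[OF peak_row_less] by (simp add: peak_def)

lemma peak_le_part_max: "j < m \<Longrightarrow> peak j y \<le> part_max {..<m} y"
  using part_value_mono[OF peak_row_less, of "{j}" "{..<m}" j] part_value_le_part_max[OF peak_row_less, of "{..<m}" y j]
  by (simp add: part_value_def peak_def)

text \<open>Each row splits into past, column \<open>k\<close> and future, and the three summands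
  are bounded by their maxima separately; the peak is the maximum for a single column.\<close>

lemma part_max_split:
  assumes "k < m"
  shows "part_max {..<m} y \<le> part_max {..<k} y + peak k y + part_max {Suc k..<m} y"
  unfolding part_max_le_iff
proof (intro allI impI)
  fix i assume i: "i < n"
  have "{..<m} = insert k ({..<k} \<union> {Suc k..<m})" using assms by auto
  moreover have "sum f ({..<k} \<union> {Suc k..<m}) = sum f {..<k} + sum f {Suc k..<m}" for f :: "nat \<Rightarrow> real"
    by (rule sum.union_disjoint) auto
  ultimately have "part_value {..<m} y i = part_value {..<k} y i + A i k * y k + part_value {Suc k..<m} y i"
    unfolding part_value_def by simp
  also have "A i k * y k \<le> peak k y"
    using y assms le_peak_row[OF i] by (simp add: peak_def mult_right_mono)
  finally show "part_value {..<m} y i \<le> part_max {..<k} y + peak k y + part_max {Suc k..<m} y"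
    using part_value_le_part_max[OF i, of "{..<k}" y] part_value_le_part_max[OF i, of "{Suc k..<m}" y]
    by linarith
qed

lemma max_attained_at_crossing:
  assumes "0 < t" "t \<le> part_max {..<m} y"
  obtains k where "k < m" "part_max {..<k} y < t" "t \<le> part_max {..<Suc k} y"
proof -
  define l where "l = (LEAST l. t \<le> part_max {..<l} y)"
  have l: "t \<le> part_max {..<l} y" unfolding l_def by (rule LeastI) (rule assms(2))
  have "l \<le> m" unfolding l_def by (rule Least_le) (rule assms(2))
  \<comment> \<open>The empty segment has maximum 0, below the positive level
    \<open>t\<close>.\<close>
  have "l \<noteq> 0" using l assms(1) by (metis lessThan_0 part_max_empty not_le)
  then obtain k where k: "l = Suc k" using not0_implies_Suc by blast
  have "\<not> t \<le> part_max {..<k} y" using k unfolding l_def by (intro not_less_Least) simp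
  with k l \<open>l \<le> m\<close> show ?thesis by (intro that[of k]) auto
qed

text \<open>Partial maxima increase with the segment, so the level is crossed at most once, and only
  if the last maximum reaches it.\<close>

lemma sum_crossing_le:
  assumes "0 < t" "N \<le> m"
  shows "(\<Sum>k<N. if part_max {..<k} y < t \<and> t \<le> part_max {..<Suc k} y then 1 else 0)
           \<le> (if t \<le> part_max {..<N} y then 1 else (0::ennreal))"
  using assms(2)
proof (induction N)
  case (Suc N)
  have "part_max {..<N} y \<le> part_max {..<Suc N} y"
    using Suc.prems by (intro part_max_mono) auto
  then show ?case using Suc by (auto split: if_splits)
qed simp

text \<open>At the crossing index the past contributes less than \<open>t\<close>, and the column
  there either less than another \<open>t\<close> or a large peak, which the last sum counts; the
  future is kept as it is.\<close>

lemma part_max_le_crossing_sum: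
  assumes "0 < t"
  shows "ennreal (part_max {..<m} y) \<le> ennreal t
    + (\<Sum>k<m. (if part_max {..<k} y < t \<and> t \<le> part_max {..<Suc k} y then 1 else 0)
               * (ennreal (2 * t) + ennreal (part_max {Suc k..<m} y)))
    + (\<Sum>j<m. if t \<le> peak j y then ennreal (peak j y) else 0)"
    (is "_ \<le> _ + sum ?f _ + sum ?g _")
proof (cases "t \<le> part_max {..<m} y")
  case True
  then obtain k where k: "k < m" "part_max {..<k} y < t" "t \<le> part_max {..<Suc k} y"
    using max_attained_at_crossing assms by blast
  have R: "0 \<le> part_max {Suc k..<m} y"
    using part_max_mono[OF empty_subsetI, of "{Suc k..<m}"] by (simp add: part_max_empty subset_eq)
  have "part_max {..<m} y \<le> t + peak k y + part_max {Suc k..<m} y"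
    using part_max_split[OF k(1)] k(2) by linarith
  also have "\<dots> \<le> (2 * t + part_max {Suc k..<m} y) + (if t \<le> peak k y then peak k y else 0)"
    using assms by auto
  finally have "ennreal (part_max {..<m} y)
      \<le> ennreal ((2 * t + part_max {Suc k..<m} y) + (if t \<le> peak k y then peak k y else 0))"
    by (rule ennreal_leI)
  also have "\<dots> = ?f k + ?g k"
    using k assms R peak_nonneg[OF k(1)] by (simp add: ennreal_plus)
  also have "\<dots> \<le> sum ?f {..<m} + sum ?g {..<m}"
    using k(1) by (intro add_mono member_le_sum) auto
  also have "\<dots> \<le> ennreal t + sum ?f {..<m} + sum ?g {..<m}"
    by (simp add: add.assoc)
  finally show ?thesis .
next
  case False
  then have "ennreal (part_max {..<m} y) \<le> ennreal t" by (intro ennreal_leI) simp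
  also have "\<dots> \<le> ennreal t + sum ?f {..<m} + sum ?g {..<m}" by (simp add: add.assoc)
  finally show ?thesis .
qed

text \<open>A nonzero summand forces its peak row to be the only row of \<open>S\<close> reaching
  \<open>t\<close>, so the rule stops there. All nonzero summands then share this row, and their
  peaks are distinct summands of its value.\<close>

lemma threshold_reward_ge:
  assumes "0 < t" "S \<subseteq> {..<n}" "G \<subseteq> {..<m}"
    and G: "\<And>j. j \<in> G \<Longrightarrow> peak_row j \<in> S"
  shows "(\<Sum>j\<in>G. (if t \<le> peak j y then ennreal (peak j y) else 0)
                 * (if \<forall>i\<in>S - {peak_row j}. part_value {..<m} y i < t then 1 else 0))
           \<le> ennreal (threshold_reward n S t (part_value {..<m} y))"
    (is "sum ?f G \<le> _")
proof (cases "\<forall>j\<in>G. ?f j = 0")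
  case False
  then obtain j where "j \<in> G" "?f j \<noteq> 0" by blast
  then have j: "j \<in> G" "t \<le> peak j y" "\<forall>i\<in>S - {peak_row j}. part_value {..<m} y i < t"
    by (simp_all split: if_splits)
  have finG: "finite G" using assms(3) finite_subset by blast
  define i where "i = peak_row j"
  have i: "i < n" "i \<in> S" using peak_row_less G[OF j(1)] by (auto simp: i_def)
  have peak_le: "(\<Sum>j\<in>G'. peak j y) \<le> part_value {..<m} y i" if "G' \<subseteq> {j\<in>G. peak_row j = i}" for G'
  proof -
    have "(\<Sum>j\<in>G'. peak j y) = part_value G' y i"
      using that by (auto simp: part_value_def peak_def intro!: sum.cong)
    also have "\<dots> \<le> part_value {..<m} y i"
      using that assms(3) by (intro part_value_mono i) auto
    finally show ?thesis .
  qed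
  have "t \<le> part_value {..<m} y i"
    using peak_le[of "{j}"] j by (auto simp: i_def)
  then have only: "i' \<in> S \<and> t \<le> part_value {..<m} y i' \<longleftrightarrow> i' = i" for i'
    using i j(3) by (force simp: i_def)
  have "find (\<lambda>i'. i' \<in> S \<and> t \<le> part_value {..<m} y i') [0..<n] = Some i"
    unfolding find_Some_iff only using i by (intro exI[of _ i]) simp
  then have reward: "threshold_reward n S t (part_value {..<m} y) = part_value {..<m} y i"
    by (simp add: threshold_reward_def)
  have "sum ?f G \<le> (\<Sum>j\<in>{j\<in>G. peak_row j = i}. ennreal (peak j y))"
  proof -
    \<comment> \<open>If the peak row of \<open>l\<close> is not \<open>i\<close>, then row
      \<open>i\<close> itself is another row of \<open>S\<close> that reaches \<open>t\<close>, and
      the indicator for \<open>l\<close> is 0.\<close>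
    have "?f l \<le> (if peak_row l = i then ennreal (peak l y) else 0)" if "l \<in> G" for l
    proof (cases "peak_row l = i")
      case False
      then have "\<not> (\<forall>i'\<in>S - {peak_row l}. part_value {..<m} y i' < t)"
        using only[of i] by (auto simp: not_less)
      then show ?thesis by (simp only: if_False) simp
    qed simp
    then have "sum ?f G \<le> (\<Sum>j\<in>G. if peak_row j = i then ennreal (peak j y) else 0)"
      by (rule sum_mono)
    also have "\<dots> = (\<Sum>j\<in>{j\<in>G. peak_row j = i}. ennreal (peak j y))"
      using finG by (simp add: sum.inter_filter)
    finally show ?thesis .
  qed
  also have "\<dots> = ennreal (\<Sum>j\<in>{j\<in>G. peak_row j = i}. peak j y)"
    using assms(3) by (intro sum_ennreal peak_nonneg) auto
  also have "\<dots> \<le> ennreal (part_value {..<m} y i)"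
    by (intro ennreal_leI peak_le order_refl)
  finally show ?thesis by (simp add: reward)
qed (simp add: sum.neutral)

end

section \<open>Bounds in expectation\<close>

lemma nn_integral_P_mono:
  assumes "\<And>y. \<forall>j<m. 0 \<le> y j \<Longrightarrow> f y \<le> g y"
  shows "(\<integral>\<^sup>+ y. f y \<partial>P) \<le> (\<integral>\<^sup>+ y. g y \<partial>P)"
  using AE_P_nonneg by (intro nn_integral_mono_AE) (auto elim!: eventually_mono intro: assms)

lemma nn_integral_P_mult:
  assumes "K \<inter> L = {}" "K \<union> L = {..<m}"
    and "a \<in> borel_measurable (PiM K \<mu>)" "\<And>x. a (restrict x K) = a x"
    and "b \<in> borel_measurable (PiM L \<mu>)" "\<And>x. b (restrict x L) = b x"
  shows "(\<integral>\<^sup>+ y. a y * b y \<partial>P) = (\<integral>\<^sup>+ y. a y \<partial>P) * (\<integral>\<^sup>+ y. b y \<partial>P)"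
proof -
  have "finite K" "finite L" using assms(2) by (metis finite_Un finite_lessThan)+
  then show ?thesis using nn_integral_PiM_mult[of K L a b] assms by simp
qed

text \<open>Decomposition at the first \<open>k\<close> for which the partial maximum reaches \<open>t\<close>, as in the
  Hoffmann-Joergensen inequality: what remains after \<open>k\<close> is independent of the past, and its
  mean is at most that of the whole maximum.\<close>

lemma expected_part_max_le:
  assumes "0 < t"
  defines "E \<equiv> \<integral>\<^sup>+ y. ennreal (part_max {..<m} y) \<partial>P"
  shows "E \<le> ennreal t + (\<integral>\<^sup>+ y. (if t \<le> part_max {..<m} y then 1 else 0) \<partial>P) * (ennreal (2 * t) + E)
           + (\<Sum>j<m. tail t j)"
proof -
  define D :: "nat \<Rightarrow> (nat \<Rightarrow> real) \<Rightarrow> ennreal"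
    where "D = (\<lambda>k y. if part_max {..<k} y < t \<and> t \<le> part_max {..<Suc k} y then 1 else 0)"
  define R :: "nat \<Rightarrow> (nat \<Rightarrow> real) \<Rightarrow> ennreal"
    where "R = (\<lambda>k y. ennreal (2 * t) + ennreal (part_max {Suc k..<m} y))"
  have D_meas: "D k \<in> borel_measurable (PiM N \<mu>)" if "{..<Suc k} \<subseteq> N" for k N
  proof -
    have "{..<k} \<subseteq> N" using that by auto
    then have [measurable]: "part_max {..<k} \<in> borel_measurable (PiM N \<mu>)" by simp
    have [measurable]: "part_max {..<Suc k} \<in> borel_measurable (PiM N \<mu>)" using that by simp
    show ?thesis unfolding D_def by measurable
  qed
  have R_meas: "R k \<in> borel_measurable (PiM N \<mu>)" if "{Suc k..<m} \<subseteq> N" for k N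
  proof -
    have [measurable]: "part_max {Suc k..<m} \<in> borel_measurable (PiM N \<mu>)" using that by simp
    show ?thesis unfolding R_def by measurable
  qed
  have D_P [measurable]: "D k \<in> borel_measurable P" if "k < m" for k
    using that by (intro D_meas) auto
  have R_P [measurable]: "R k \<in> borel_measurable P" for k
    by (intro R_meas) auto
  have peak_P: "(\<lambda>y. if t \<le> peak j y then ennreal (peak j y) else 0) \<in> borel_measurable P" if "j < m" for j
  proof -
    have [measurable]: "peak j \<in> borel_measurable P" using that by simp
    show ?thesis by measurable
  qed
  have [measurable]: "part_max {..<m} \<in> borel_measurable P" by simp
  have step: "(\<integral>\<^sup>+ y. D k y * R k y \<partial>P) \<le> (\<integral>\<^sup>+ y. D k y \<partial>P) * (ennreal (2 * t) + E)" if k: "k < m" for k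
  proof -
    have "restrict (restrict y {..<Suc k}) {..<k} = restrict y {..<k}" for y :: "nat \<Rightarrow> real"
      by (auto simp: restrict_def fun_eq_iff)
    then have "part_max {..<k} (restrict y {..<Suc k}) = part_max {..<k} y" for y
      by (metis part_max_restrict)
    then have "(\<integral>\<^sup>+ y. D k y * R k y \<partial>P) = (\<integral>\<^sup>+ y. D k y \<partial>P) * (\<integral>\<^sup>+ y. R k y \<partial>P)"
      using k by (intro nn_integral_P_mult[of "{..<Suc k}" "{Suc k..<m}"] D_meas R_meas)
        (auto simp: D_def R_def part_max_restrict)
    also have "(\<integral>\<^sup>+ y. R k y \<partial>P) \<le> (\<integral>\<^sup>+ y. ennreal (2 * t) + ennreal (part_max {..<m} y) \<partial>P)"
      unfolding R_def
      by (intro nn_integral_P_mono add_left_mono ennreal_leI part_max_mono) auto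
    also have "\<dots> = ennreal (2 * t) + E"
      unfolding E_def by (subst nn_integral_add) (auto simp: P.emeasure_space_1)
    finally show ?thesis by (simp add: mult_left_mono)
  qed
  have "E \<le> (\<integral>\<^sup>+ y. ennreal t + (\<Sum>k<m. D k y * R k y)
      + (\<Sum>j<m. if t \<le> peak j y then ennreal (peak j y) else 0) \<partial>P)"
    unfolding E_def D_def R_def
    by (intro nn_integral_P_mono part_max_le_crossing_sum assms(1))
  also have "\<dots> = ennreal t + (\<Sum>k<m. \<integral>\<^sup>+ y. D k y * R k y \<partial>P) + (\<Sum>j<m. tail t j)"
  proof -
    have DR: "(\<lambda>y. D k y * R k y) \<in> borel_measurable P" if "k < m" for k
      using D_P[OF that] R_P[of k] by measurable
    then have "(\<lambda>y. \<Sum>k<m. D k y * R k y) \<in> borel_measurable P"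
      by (intro borel_measurable_sum) simp
    moreover have "(\<integral>\<^sup>+ y. (\<Sum>k<m. D k y * R k y) \<partial>P) = (\<Sum>k<m. \<integral>\<^sup>+ y. D k y * R k y \<partial>P)"
      using DR by (intro nn_integral_sum) simp
    ultimately show ?thesis
      using peak_P unfolding tail_def
      by (simp add: nn_integral_add nn_integral_sum P.emeasure_space_1)
  qed
  also have "(\<Sum>k<m. \<integral>\<^sup>+ y. D k y * R k y \<partial>P)
      \<le> (\<Sum>k<m. \<integral>\<^sup>+ y. D k y \<partial>P) * (ennreal (2 * t) + E)"
    unfolding sum_distrib_right by (intro sum_mono step) simp
  also have "(\<Sum>k<m. \<integral>\<^sup>+ y. D k y \<partial>P) = (\<integral>\<^sup>+ y. (\<Sum>k<m. D k y) \<partial>P)"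
    using D_P by (intro nn_integral_sum[symmetric]) simp
  \<comment> \<open>The crossing events for different \<open>k\<close> are disjoint, so their
    probabilities add up to at most that of the maximum reaching \<open>t\<close>.\<close>
  also have "\<dots> \<le> (\<integral>\<^sup>+ y. (if t \<le> part_max {..<m} y then 1 else 0) \<partial>P)"
    unfolding D_def
    by (intro nn_integral_P_mono sum_crossing_le assms(1)) auto
  finally show ?thesis
    by (simp add: add_mono mult_right_mono)
qed

text \<open>Rows of \<open>S\<close> other than the peak row of \<open>j\<close> do not involve
  \<open>y j\<close>, so the event that they all stay below \<open>t\<close> is independent of the
  peak; it contains the event that the whole maximum stays below \<open>t\<close>.\<close>

lemma sum_tail_le_expected_reward:
  assumes "0 < t" "S \<subseteq> {..<n}" "G \<subseteq> {..<m}"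
    and G: "\<And>j. j \<in> G \<Longrightarrow> peak_row j \<in> S" "\<And>i j. j \<in> G \<Longrightarrow> i \<in> S \<Longrightarrow> i \<noteq> peak_row j \<Longrightarrow> A i j = 0"
  shows "(\<Sum>j\<in>G. tail t j) * (\<integral>\<^sup>+ y. (if part_max {..<m} y < t then 1 else 0) \<partial>P)
           \<le> (\<integral>\<^sup>+ y. ennreal (threshold_reward n S t (lin_value m A y)) \<partial>P)"
proof -
  define f :: "nat \<Rightarrow> (nat \<Rightarrow> real) \<Rightarrow> ennreal"
    where "f = (\<lambda>j y. if t \<le> peak j y then ennreal (peak j y) else 0)"
  define g :: "nat \<Rightarrow> (nat \<Rightarrow> real) \<Rightarrow> ennreal"
    where "g = (\<lambda>j y. if \<forall>i\<in>S - {peak_row j}. part_value {..<m} y i < t then 1 else 0)"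
  have f_meas: "f j \<in> borel_measurable (PiM N \<mu>)" if "j \<in> N" for j N
  proof -
    have [measurable]: "peak j \<in> borel_measurable (PiM N \<mu>)" using that by simp
    show ?thesis unfolding f_def by measurable
  qed
  \<comment> \<open>Deleting column \<open>j\<close> exhibits \<open>g j\<close> as a function of
    the other coordinates, which is the form that independence requires.\<close>
  have g_eq: "g j = (\<lambda>y. if \<forall>i\<in>S - {peak_row j}. part_value ({..<m} - {j}) y i < t then 1 else 0)"
    if j: "j \<in> G" for j
  proof -
    have "part_value {..<m} y i = part_value ({..<m} - {j}) y i" if "i \<in> S - {peak_row j}" for y i
      using that G(2)[OF j, of i] by (auto simp: part_value_def intro!: sum.mono_neutral_right)
    then have "(\<forall>i\<in>S - {peak_row j}. part_value {..<m} y i < t)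
        \<longleftrightarrow> (\<forall>i\<in>S - {peak_row j}. part_value ({..<m} - {j}) y i < t)" for y
      by (intro ball_cong) auto
    then show ?thesis by (simp add: g_def)
  qed
  have g_meas: "g j \<in> borel_measurable (PiM N \<mu>)" if "j \<in> G" "{..<m} - {j} \<subseteq> N" for j N
  proof -
    have [measurable]: "(\<lambda>y. part_value ({..<m} - {j}) y i) \<in> borel_measurable (PiM N \<mu>)" for i
      using that by simp
    have "finite (S - {peak_row j})" using assms(2) finite_subset by blast
    then have [measurable]: "Measurable.pred (PiM N \<mu>) (\<lambda>y. \<forall>i\<in>S - {peak_row j}. part_value ({..<m} - {j}) y i < t)"
      by (intro pred_intros_finite) measurable
    show ?thesis unfolding g_eq[OF that(1)] by measurable
  qed
  have "(\<Sum>j\<in>G. tail t j) * (\<integral>\<^sup>+ y. (if part_max {..<m} y < t then 1 else 0) \<partial>P)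
      \<le> (\<Sum>j\<in>G. tail t j * (\<integral>\<^sup>+ y. g j y \<partial>P))"
    unfolding sum_distrib_right
  proof (intro sum_mono mult_left_mono nn_integral_mono)
    fix j y
    show "(if part_max {..<m} y < t then 1 else 0) \<le> g j y"
      using part_value_le_part_max[of _ "{..<m}" y] assms(2) by (force simp: g_def)
  qed simp
  also have "\<dots> = (\<Sum>j\<in>G. \<integral>\<^sup>+ y. f j y * g j y \<partial>P)"
  proof (intro sum.cong refl)
    fix j assume j: "j \<in> G"
    have "(\<integral>\<^sup>+ y. f j y * g j y \<partial>P) = (\<integral>\<^sup>+ y. f j y \<partial>P) * (\<integral>\<^sup>+ y. g j y \<partial>P)"
      using j assms(3) by (intro nn_integral_P_mult[of "{j}" "{..<m} - {j}"] f_meas g_meas)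
        (auto simp: f_def peak_def g_eq part_value_restrict)
    then show "tail t j * (\<integral>\<^sup>+ y. g j y \<partial>P) = (\<integral>\<^sup>+ y. f j y * g j y \<partial>P)"
      by (simp add: tail_def f_def)
  qed
  also have "\<dots> = (\<integral>\<^sup>+ y. (\<Sum>j\<in>G. f j y * g j y) \<partial>P)"
    using assms(3) by (intro nn_integral_sum[symmetric] borel_measurable_times_ennreal f_meas g_meas) auto
  also have "\<dots> \<le> (\<integral>\<^sup>+ y. ennreal (threshold_reward n S t (lin_value m A y)) \<partial>P)"
    unfolding lin_value_eq f_def g_def
    by (intro nn_integral_P_mono threshold_reward_ge assms(1-3) G)
  finally show ?thesis .
qed

section \<open>Choosing rows that isolate peaks\<close>

text \<open>Rows are sampled, and the conflicts of column \<open>j\<close> are the other rows in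
  which it occurs. In an application \<open>w\<close> is the vector of truncated peak means.\<close>

lemma exists_private_rows_of_col_sparsity:
  fixes w :: "nat \<Rightarrow> real"
  assumes w: "\<And>j. j < m \<Longrightarrow> 0 \<le> w j" "\<And>j. j < m \<Longrightarrow> A (peak_row j) j = 0 \<Longrightarrow> w j = 0"
  shows "\<exists>S\<subseteq>{..<n}. \<exists>G\<subseteq>{..<m}. (\<forall>j\<in>G. peak_row j \<in> S \<and> (\<forall>i\<in>S. i \<noteq> peak_row j \<longrightarrow> A i j = 0)) \<and>
           sum w {..<m} \<le> 3 * real (col_sparsity n m A) * sum w G"
proof -
  \<comment> \<open>Columns with vanishing peak entry carry no weight. In the others the peak row is
    one of the nonzero entries, so strictly fewer conflicts than the column sparsity remain.\<close>
  define J where "J = {j. j < m \<and> A (peak_row j) j \<noteq> 0}"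
  define B where "B = (\<lambda>j. {i. i < n \<and> A i j \<noteq> 0} - {peak_row j})"
  have card: "card (B j) < col_sparsity n m A" if "j \<in> J" for j
  proof -
    have "card (B j) < card {i. i < n \<and> A i j \<noteq> 0}"
      using that peak_row_less[of j] unfolding B_def J_def by (intro card_Diff1_less) auto
    also have "\<dots> \<le> col_sparsity n m A"
      using that unfolding col_sparsity_def J_def by (intro Max_ge) auto
    finally show ?thesis .
  qed
  obtain R where R: "R \<subseteq> {..<n}" "sum w J \<le> 3 * real (col_sparsity n m A)
      * sum w {j\<in>J. peak_row j \<in> R \<and> R \<inter> B j = {}}"
    using exists_sampled_subset[of "{..<n}" J peak_row B "col_sparsity n m A" w] card w(1) peak_row_less
    by (auto simp: J_def B_def)
  have "sum w {..<m} = sum w J"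
    using w(2) by (intro sum.mono_neutral_right) (auto simp: J_def)
  with R show ?thesis
    by (intro exI[of _ R] exI[of _ "{j\<in>J. peak_row j \<in> R \<and> R \<inter> B j = {}}"] conjI)
      (auto simp: J_def B_def)
qed

text \<open>Here the columns are sampled, and a row is included when it meets the sample in exactly one
  column, of which it is the peak row.\<close>

lemma exists_private_rows_of_row_sparsity:
  fixes w :: "nat \<Rightarrow> real"
  assumes w: "\<And>j. j < m \<Longrightarrow> 0 \<le> w j" "\<And>j. j < m \<Longrightarrow> A (peak_row j) j = 0 \<Longrightarrow> w j = 0"
  shows "\<exists>S\<subseteq>{..<n}. \<exists>G\<subseteq>{..<m}. (\<forall>j\<in>G. peak_row j \<in> S \<and> (\<forall>i\<in>S. i \<noteq> peak_row j \<longrightarrow> A i j = 0)) \<and>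
           sum w {..<m} \<le> 3 * real (row_sparsity n m A) * sum w G"
proof -
  define J where "J = {j. j < m \<and> A (peak_row j) j \<noteq> 0}"
  \<comment> \<open>Conflicts are now columns: a second sampled column in the peak row of
    \<open>j\<close> would spoil that row. Column \<open>j\<close> itself accounts for the strict
    bound by the row sparsity.\<close>
  define B where "B = (\<lambda>j. {j'. j' < m \<and> A (peak_row j) j' \<noteq> 0} - {j})"
  have card: "card (B j) < row_sparsity n m A" if "j \<in> J" for j
  proof -
    have "card (B j) < card {j'. j' < m \<and> A (peak_row j) j' \<noteq> 0}"
      using that unfolding B_def J_def by (intro card_Diff1_less) auto
    also have "\<dots> \<le> row_sparsity n m A"
      using peak_row_less[of j] unfolding row_sparsity_def by (intro Max_ge) auto
    finally show ?thesis .
  qed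
  obtain R where R: "R \<subseteq> {..<m}" "sum w J \<le> 3 * real (row_sparsity n m A)
      * sum w {j\<in>J. j \<in> R \<and> R \<inter> B j = {}}"
    using exists_sampled_subset[of "{..<m}" J "\<lambda>j. j" B "row_sparsity n m A" w] card w(1)
    by (auto simp: J_def B_def)
  define S where "S = {i. i < n \<and> (\<exists>j. peak_row j = i \<and> {j'\<in>R. A i j' \<noteq> 0} = {j})}"
  define G where "G = {j\<in>J. j \<in> R \<and> R \<inter> B j = {}}"
  have "peak_row j \<in> S \<and> (\<forall>i\<in>S. i \<noteq> peak_row j \<longrightarrow> A i j = 0)" if "j \<in> G" for j
  proof -
    have supp: "{j'\<in>R. A (peak_row j) j' \<noteq> 0} = {j}"
      using that R(1) by (auto simp: G_def J_def B_def)
    have "A i j = 0" if i: "i \<in> S" "i \<noteq> peak_row j" for i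
    proof (rule ccontr)
      \<comment> \<open>A row of \<open>S\<close> meets the sample in a single column, whose peak
        row it is; if it involves the sampled column \<open>j\<close>, that column is
        \<open>j\<close>.\<close>
      obtain l where l: "peak_row l = i" "{j'\<in>R. A i j' \<noteq> 0} = {l}"
        using i(1) unfolding S_def by blast
      assume "A i j \<noteq> 0"
      moreover have "j \<in> R" using supp by blast
      ultimately have "j = l" using l(2) by blast
      with l(1) i(2) show False by simp
    qed
    then show ?thesis using supp peak_row_less[of j] unfolding S_def by blast
  qed
  moreover have "sum w {..<m} = sum w J"
    using w(2) by (intro sum.mono_neutral_right) (auto simp: J_def)
  moreover have "S \<subseteq> {..<n}" "G \<subseteq> {..<m}" by (auto simp: S_def G_def J_def)
  ultimately show ?thesis
    using R(2) unfolding G_def[symmetric]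
    by (intro exI[of _ S] exI[of _ G] conjI ballI) simp_all
qed

lemma exists_private_rows:
  fixes w :: "nat \<Rightarrow> real"
  assumes w: "\<And>j. j < m \<Longrightarrow> 0 \<le> w j" "\<And>j. j < m \<Longrightarrow> A (peak_row j) j = 0 \<Longrightarrow> w j = 0"
  obtains S G where "S \<subseteq> {..<n}" "G \<subseteq> {..<m}" "\<And>j. j \<in> G \<Longrightarrow> peak_row j \<in> S"
    "\<And>i j. j \<in> G \<Longrightarrow> i \<in> S \<Longrightarrow> i \<noteq> peak_row j \<Longrightarrow> A i j = 0"
    "sum w {..<m} \<le> 3 * real (min (col_sparsity n m A) (row_sparsity n m A)) * sum w G"
proof (cases "col_sparsity n m A \<le> row_sparsity n m A")
  case True
  then have "min (col_sparsity n m A) (row_sparsity n m A) = col_sparsity n m A" by simp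
  with exists_private_rows_of_col_sparsity[of w] w that show ?thesis by metis
next
  case False
  then have "min (col_sparsity n m A) (row_sparsity n m A) = row_sparsity n m A" by simp
  with exists_private_rows_of_row_sparsity[of w] w that show ?thesis by metis
qed

section \<open>Choice of the threshold\<close>

lemma expected_reward_singleton:
  assumes "i < n"
  shows "(\<integral>\<^sup>+ y. ennreal (part_value {..<m} y i) \<partial>P)
           \<le> (\<integral>\<^sup>+ y. ennreal (threshold_reward n {i} 0 (lin_value m A y)) \<partial>P)"
proof (rule nn_integral_P_mono)
  fix y :: "nat \<Rightarrow> real" assume y: "\<forall>j<m. 0 \<le> y j"
  have "0 \<le> part_value {..<m} y i" using part_value_nonneg[OF y assms] by simp
  then have "find (\<lambda>i'. i' \<in> {i} \<and> 0 \<le> part_value {..<m} y i') [0..<n] = Some i"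
    unfolding find_Some_iff using assms by (intro exI[of _ i]) auto
  then show "ennreal (part_value {..<m} y i) \<le> ennreal (threshold_reward n {i} 0 (lin_value m A y))"
    by (simp add: threshold_reward_def lin_value_eq)
qed

text \<open>Whenever the maximum reaches \<open>t\<close>, the rule stops at some row and collects
  at least \<open>t\<close>.\<close>

lemma expected_reward_all_rows:
  assumes "0 \<le> t"
  shows "ennreal t * (\<integral>\<^sup>+ y. (if t \<le> part_max {..<m} y then 1 else 0) \<partial>P)
           \<le> (\<integral>\<^sup>+ y. ennreal (threshold_reward n {..<n} t (lin_value m A y)) \<partial>P)"
proof -
  have [measurable]: "part_max {..<m} \<in> borel_measurable P" by simp
  have "ennreal t * (\<integral>\<^sup>+ y. (if t \<le> part_max {..<m} y then 1 else 0) \<partial>P)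
      = (\<integral>\<^sup>+ y. ennreal t * (if t \<le> part_max {..<m} y then 1 else 0) \<partial>P)"
    by (rule nn_integral_cmult[symmetric]) measurable
  also have "\<dots> \<le> (\<integral>\<^sup>+ y. ennreal (threshold_reward n {..<n} t (lin_value m A y)) \<partial>P)"
  proof (rule nn_integral_mono)
    fix y :: "nat \<Rightarrow> real"
    show "ennreal t * (if t \<le> part_max {..<m} y then 1 else 0)
        \<le> ennreal (threshold_reward n {..<n} t (lin_value m A y))"
    proof (cases "t \<le> part_max {..<m} y")
      case True
      then obtain i where "i < n" "t \<le> part_value {..<m} y i"
        using part_max_attained[of "{..<m}" y] by auto
      then obtain i' where "find (\<lambda>i. i \<in> {..<n} \<and> t \<le> part_value {..<m} y i) [0..<n] = Some i'"
        by (cases "find (\<lambda>i. i \<in> {..<n} \<and> t \<le> part_value {..<m} y i) [0..<n]")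
          (auto simp: find_None_iff)
      moreover from this have "t \<le> part_value {..<m} y i'"
        by (auto simp: find_Some_iff)
      ultimately show ?thesis
        using True by (simp add: threshold_reward_def lin_value_eq ennreal_leI)
    qed simp
  qed
  finally show ?thesis .
qed

text \<open>The maximum is at most the sum of the finitely many row values, so one row has infinite
  mean; with threshold 0 that row is almost surely accepted.\<close>

lemma exists_threshold_rule_of_infinite_mean:
  assumes "(\<integral>\<^sup>+ y. ennreal (part_max {..<m} y) \<partial>P) = \<infinity>"
  shows "\<exists>i<n. (\<integral>\<^sup>+ y. ennreal (threshold_reward n {i} 0 (lin_value m A y)) \<partial>P) = \<infinity>"
proof -
  have "\<infinity> \<le> (\<integral>\<^sup>+ y. (\<Sum>i<n. ennreal (part_value {..<m} y i)) \<partial>P)"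
    unfolding assms[symmetric]
  proof (rule nn_integral_mono)
    fix y :: "nat \<Rightarrow> real"
    obtain i where "i < n" "part_value {..<m} y i = part_max {..<m} y"
      using part_max_attained by blast
    then show "ennreal (part_max {..<m} y) \<le> (\<Sum>i<n. ennreal (part_value {..<m} y i))"
      using member_le_sum[of i "{..<n}" "\<lambda>i. ennreal (part_value {..<m} y i)"] by simp
  qed
  also have "\<dots> = (\<Sum>i<n. \<integral>\<^sup>+ y. ennreal (part_value {..<m} y i) \<partial>P)"
    by (intro nn_integral_sum measurable_compose[OF _ measurable_ennreal]) simp
  finally obtain i where "i < n" "(\<integral>\<^sup>+ y. ennreal (part_value {..<m} y i) \<partial>P) = \<infinity>"
    by (auto simp: top_unique ennreal_sum_eq_top)
  then show ?thesis
    using expected_reward_singleton[of i] by (auto simp: top_unique)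
qed

lemma exists_threshold_rule:
  "\<exists>S\<subseteq>{..<n}. \<exists>t.
     ennreal (1 / (24 * real (min (col_sparsity n m A) (row_sparsity n m A))))
       * (\<integral>\<^sup>+ y. ennreal (part_max {..<m} y) \<partial>P)
     \<le> (\<integral>\<^sup>+ y. ennreal (threshold_reward n S t (lin_value m A y)) \<partial>P)"
proof -
  define E where "E = (\<integral>\<^sup>+ y. ennreal (part_max {..<m} y) \<partial>P)"
  define s where "s = min (col_sparsity n m A) (row_sparsity n m A)"
  \<comment> \<open>For \<open>s = 0\<close> the factor \<open>1 / (24 * real s)\<close> is 0 by the
    convention for division, and the bound is trivial.\<close>
  consider "s = 0 \<or> E = 0" | "E = \<infinity>" | r where "s \<noteq> 0" "0 < r" "E = ennreal r"
  proof (cases E)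
    case (real r)
    then show ?thesis using that by (cases "r = 0") auto
  qed (use that in auto)
  then show ?thesis
    unfolding E_def[symmetric] s_def[symmetric]
  proof cases
    case 1
    then show "\<exists>S\<subseteq>{..<n}. \<exists>t. ennreal (1 / (24 * real s)) * E
        \<le> (\<integral>\<^sup>+ y. ennreal (threshold_reward n S t (lin_value m A y)) \<partial>P)" by auto
  next
    case 2
    then obtain i where "i < n" "(\<integral>\<^sup>+ y. ennreal (threshold_reward n {i} 0 (lin_value m A y)) \<partial>P) = \<infinity>"
      using exists_threshold_rule_of_infinite_mean unfolding E_def by blast
    then show "\<exists>S\<subseteq>{..<n}. \<exists>t. ennreal (1 / (24 * real s)) * E
        \<le> (\<integral>\<^sup>+ y. ennreal (threshold_reward n S t (lin_value m A y)) \<partial>P)"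
      by (intro exI[of _ "{i}"] exI[of _ 0] conjI) auto
  next
    case 3
    \<comment> \<open>With \<open>t = r / 8\<close> and \<open>p' \<le> 1 / 2\<close>, the terms
      \<open>t + p' * (2 * t + r)\<close> come to at most \<open>3 * r / 4\<close>, which leaves
      \<open>r / 4\<close> to the large peaks.\<close>
    define t where "t = r / 8"
    have t: "0 < t" using 3 by (simp add: t_def)
    define p where "p = (\<integral>\<^sup>+ y. (if t \<le> part_max {..<m} y then 1 else 0 :: ennreal) \<partial>P)"
    define q where "q = (\<integral>\<^sup>+ y. (if part_max {..<m} y < t then 1 else 0 :: ennreal) \<partial>P)"
    have [measurable]: "part_max {..<m} \<in> borel_measurable P" by simp
    have "p + q = (\<integral>\<^sup>+ y. (if t \<le> part_max {..<m} y then 1 else 0) + (if part_max {..<m} y < t then 1 else 0) \<partial>P)"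
      unfolding p_def q_def by (rule nn_integral_add[symmetric]) measurable
    also have "\<dots> = (\<integral>\<^sup>+ y. 1 \<partial>P)" by (intro nn_integral_cong) auto
    finally have "p + q = 1" by (simp add: P.emeasure_space_1)
    then obtain p' where p': "0 \<le> p'" "p = ennreal p'" by (cases p) auto
    obtain q' where q': "0 \<le> q'" "q = ennreal q'" using \<open>p + q = 1\<close> by (cases q) auto
    have pq: "p' + q' = 1"
      using \<open>p + q = 1\<close> p' q' by (simp flip: ennreal_plus)
    show "\<exists>S\<subseteq>{..<n}. \<exists>t. ennreal (1 / (24 * real s)) * E
        \<le> (\<integral>\<^sup>+ y. ennreal (threshold_reward n S t (lin_value m A y)) \<partial>P)"
    proof (cases "1 / 2 \<le> p'")
      case True
      \<comment> \<open>Here \<open>t * p'\<close> is at least \<open>r / 16\<close>, and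
        \<open>s \<ge> 1\<close>.\<close>
      have "r / (24 * real s) \<le> t * p'"
      proof -
        have "r / (24 * real s) \<le> r / 24"
          using 3 by (intro divide_left_mono) auto
        also have "\<dots> \<le> t * (1 / 2)" using 3 by (simp add: t_def)
        also have "\<dots> \<le> t * p'" using True t by (intro mult_left_mono) auto
        finally show ?thesis .
      qed
      then have "ennreal (1 / (24 * real s)) * E \<le> ennreal t * p"
        using 3 p' t by (simp add: ennreal_leI flip: ennreal_mult')
      also have "\<dots> \<le> (\<integral>\<^sup>+ y. ennreal (threshold_reward n {..<n} t (lin_value m A y)) \<partial>P)"
        unfolding p_def using t by (intro expected_reward_all_rows) simp
      finally show ?thesis by blast
    next
      case False
      have tail_le: "tail t j \<le> E" if "j < m" for j
        unfolding tail_def E_def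
        using peak_le_part_max that by (intro nn_integral_P_mono) (auto intro: ennreal_leI)
      \<comment> \<open>The sampling lemmas take real weights; the truncated means are finite, being
        at most \<open>E\<close>.\<close>
      define w where "w = (\<lambda>j. enn2real (tail t j))"
      have tail_eq: "tail t j = ennreal (w j)" if "j < m" for j
        unfolding w_def using tail_le[OF that] 3
        by (metis ennreal_enn2real ennreal_less_top order_le_less_trans)
      have sum_tail: "(\<Sum>j\<in>G. tail t j) = ennreal (sum w G)" if "G \<subseteq> {..<m}" for G
      proof -
        have "(\<Sum>j\<in>G. tail t j) = (\<Sum>j\<in>G. ennreal (w j))"
          using that tail_eq by (intro sum.cong) auto
        then show ?thesis by (simp add: w_def sum_ennreal)
      qed
      have w_nonneg: "0 \<le> w j" for j by (simp add: w_def)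
      have "w j = 0" if "A (peak_row j) j = 0" for j
        using that t by (simp add: w_def tail_def peak_def)
      then obtain S G where SG: "S \<subseteq> {..<n}" "G \<subseteq> {..<m}" "\<And>j. j \<in> G \<Longrightarrow> peak_row j \<in> S"
          "\<And>i j. j \<in> G \<Longrightarrow> i \<in> S \<Longrightarrow> i \<noteq> peak_row j \<Longrightarrow> A i j = 0"
          "sum w {..<m} \<le> 3 * real s * sum w G"
        using exists_private_rows[of w] w_nonneg unfolding s_def by metis
      have "ennreal r \<le> ennreal (t + p' * (2 * t + r) + sum w {..<m})"
        using expected_part_max_le[OF t] sum_tail[of "{..<m}"] 3 t p' w_nonneg
        by (simp add: ennreal_plus ennreal_mult' sum_nonneg flip: E_def p_def)
      then have "r \<le> t + p' * (2 * t + r) + sum w {..<m}"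
        using t p' 3 w_nonneg by (subst (asm) ennreal_le_iff) (auto intro!: add_nonneg_nonneg sum_nonneg)
      moreover have "p' * (2 * t + r) \<le> 1 / 2 * (2 * t + r)"
        using False t 3 by (intro mult_right_mono) auto
      ultimately have "r / 4 \<le> sum w {..<m}" by (simp add: t_def)
      with SG(5) have "r / 4 \<le> 3 * real s * sum w G" by simp
      \<comment> \<open>The constant is \<open>24 = 4 * 3 * 2\<close>: a quarter of the mean lies in
        large peaks, sampling loses \<open>3 * s\<close>, and the other rows stay below
        \<open>t\<close> with probability at least one half.\<close>
      then have "r / (24 * real s) \<le> sum w G * (1 / 2)" using 3 by (simp add: field_simps)
      also have "\<dots> \<le> sum w G * q'"
        using False pq w_nonneg by (intro mult_left_mono sum_nonneg) auto
      finally have "ennreal (1 / (24 * real s)) * E \<le> (\<Sum>j\<in>G. tail t j) * q"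
        using 3 q' w_nonneg sum_tail[OF SG(2)]
        by (simp add: ennreal_leI sum_nonneg flip: ennreal_mult')
      also have "\<dots> \<le> (\<integral>\<^sup>+ y. ennreal (threshold_reward n S t (lin_value m A y)) \<partial>P)"
        unfolding q_def by (intro sum_tail_le_expected_reward t SG)
      finally show ?thesis using SG(1) by blast
    qed
  qed
qed

end

section \<open>From a fixed set and threshold to an algorithm\<close>

text \<open>A deterministic choice is the point mass at \<open>(S, t)\<close>; by Tonelli the
  integral over the draw collapses to an evaluation.\<close>

lemma expected_reward_return:
  fixes t :: real
  assumes inst: "lin_instance n m A \<mu>" and S: "S \<subseteq> {..<n}"
  defines "D \<equiv> return (count_space (Pow {..<n}) \<Otimes>\<^sub>M (borel :: real measure)) (S, t)"
  shows "inclusion_threshold_alg n D"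
    and "expected_reward n m A \<mu> D
           = (\<integral>\<^sup>+ y. ennreal (threshold_reward n S t (lin_value m A y)) \<partial>PiM {..<m} \<mu>)"
proof -
  let ?N = "count_space (Pow {..<n}) \<Otimes>\<^sub>M (borel :: real measure)"
  let ?P = "PiM {..<m} \<mu>"
  have space: "(S, t) \<in> space ?N" using S by (simp add: space_pair_measure)
  show "inclusion_threshold_alg n D"
    unfolding inclusion_threshold_alg_def D_def by (simp add: prob_space_return[OF space])
  have sets_D: "sets D = sets ?N" by (simp add: D_def)
  interpret P: prob_space ?P
    using inst by (intro prob_space_PiM) (auto simp: lin_instance_def)
  let ?f = "\<lambda>((S, \<tau>), y). ennreal (threshold_reward n S \<tau> (lin_value m A y))"
  have "(\<lambda>p. ennreal ((\<lambda>((S, \<tau>), y). threshold_reward n S \<tau> (lin_value m A y)) p)) \<in> borel_measurable (D \<Otimes>\<^sub>M ?P)"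
    using threshold_reward_measurable[of m \<mu> D n A] inst sets_D
    by (intro measurable_compose[OF _ measurable_ennreal]) (auto simp: lin_instance_def)
  then have f: "?f \<in> borel_measurable (D \<Otimes>\<^sub>M ?P)" by (simp add: case_prod_beta')
  have inner: "(\<lambda>x. \<integral>\<^sup>+ y. ?f (x, y) \<partial>?P) \<in> borel_measurable ?N"
    using P.borel_measurable_nn_integral_fst[OF f] by (simp add: D_def)
  have "expected_reward n m A \<mu> D = (\<integral>\<^sup>+ x. \<integral>\<^sup>+ y. ?f (x, y) \<partial>?P \<partial>D)"
    unfolding expected_reward_def by (rule P.nn_integral_fst[OF f, symmetric])
  also have "\<dots> = (\<integral>\<^sup>+ y. ?f ((S, t), y) \<partial>?P)"
    unfolding D_def by (rule nn_integral_return[OF space inner])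
  finally show "expected_reward n m A \<mu> D
      = (\<integral>\<^sup>+ y. ennreal (threshold_reward n S t (lin_value m A y)) \<partial>?P)" by simp
qed

theorem theorem4p1:
  "\<exists>C::real. 0 < C \<and>
     (\<forall>(n::nat) (m::nat) (A :: nat \<Rightarrow> nat \<Rightarrow> real) (\<mu> :: nat \<Rightarrow> real measure).
        lin_instance n m A \<mu> \<longrightarrow>
        (\<exists>D. inclusion_threshold_alg n D \<and>
             expected_reward n m A \<mu> D
               \<ge> ennreal (1 / (C * real (min (col_sparsity n m A) (row_sparsity n m A))))
                 * expected_max n m A \<mu>))"
proof (intro exI[of _ 24] conjI allI impI)
  fix n m :: nat and A :: "nat \<Rightarrow> nat \<Rightarrow> real" and \<mu> :: "nat \<Rightarrow> real measure"
  assume inst: "lin_instance n m A \<mu>"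
  \<comment> \<open>Padding with point masses at 0 makes the laws probability measures at every
    index and leaves the product over \<open>{..<m}\<close> unchanged.\<close>
  define \<nu> where "\<nu> = (\<lambda>j. if j < m then \<mu> j else return borel 0)"
  interpret linear_prophet n m A \<nu>
  proof (rule linear_prophet.intro)
    show "prob_space (\<nu> j)" "sets (\<nu> j) = sets borel" for j
      using inst by (simp_all add: lin_instance_def \<nu>_def prob_space_return)
    show "AE y in \<nu> j. 0 \<le> y" if "j < m" for j
    proof -
      have "AE y in \<mu> j. 0 \<le> y" using inst that by (simp add: lin_instance_def)
      moreover have "\<nu> j = \<mu> j" using that by (simp add: \<nu>_def)
      ultimately show ?thesis by metis
    qed
  qed (use inst in \<open>simp_all add: lin_instance_def\<close>)
  have "PiM {..<m} \<mu> = P"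
    by (intro PiM_cong) (auto simp: \<nu>_def)
  then obtain S t where "S \<subseteq> {..<n}"
    "ennreal (1 / (24 * real (min (col_sparsity n m A) (row_sparsity n m A)))) * expected_max n m A \<mu>
      \<le> (\<integral>\<^sup>+ y. ennreal (threshold_reward n S t (lin_value m A y)) \<partial>PiM {..<m} \<mu>)"
    using exists_threshold_rule unfolding expected_max_def max_value_eq by auto
  then show "\<exists>D. inclusion_threshold_alg n D \<and> expected_reward n m A \<mu> D
      \<ge> ennreal (1 / (24 * real (min (col_sparsity n m A) (row_sparsity n m A)))) * expected_max n m A \<mu>"
    using expected_reward_return[OF inst] by metis
qed simp

end
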